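(* Let $T$ be a rank one construction on an infinite measure space $(X,\mu)$ with cuttings $r_j\to\infty$, and suppose that $T$ is a Sidon construction, i.e. for every $j$ and every integer $m$ with $h_j<m<h_{j+1}$ the intersection $U_j\cap T^mU_j$ is contained in a single column of $U_j$. Then $T$ is mixing.
   Context: Rank one construction: it is determined by $h_1$, a sequence of integers $r_j$ (cuttings), and a sequence of spacer vectors $(s_j(1),\dots,s_j(r_j))$ of nonnegative integers. At step $j$ one has a tower of disjoint sets (intervals of equal finite measure) $E_j,TE_j,\dots,T^{h_j}E_j$, on which $T$ is defined except on the top level. Cut $E_j$ into $r_j$ subintervals $E_j^1,\dots,E_j^{r_j}$ of equal measure, giving columns $E_j^i,TE_j^i,\dots,T^{h_j}E_j^i$. Above the $i$-th column add $s_j(i)$ new disjoint intervals (spacers) of the same measure as $E_j^i$, giving $E_j^i,TE_j^i,\dots,T^{h_j+s_j(i)}E_j^i$, and for $i<r_j$ set $T\,T^{h_j+s_j(i)}E_j^i=E_j^{i+1}$. This gives the tower $E_{j+1},TE_{j+1},\dots,T^{h_{j+1}}E_{j+1}$ with $E_{j+1}=E_j^1$ and $h_{j+1}+1=(h_j+1)r_j+\sum_{i=1}^{r_j}s_j(i)$. The space $X$ is the union of all the towers, $\mu$ is Lebesgue measure on it, and $T$ is the resulting invertible measure-preserving transformation. Put $U_j=\bigsqcup_{i=0}^{h_j}T^iE_j$. The columns of $U_j$ are the sets $\bigsqcup_{n=0}^{h_j}T^nE_j^i$, $i=1,\dots,r_j$. Mixing (infinite measure): for any $\varepsilon>0$ and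 any sets $A,B$ of finite measure there is $N$ such that $\mu(T^kA\cap B)<\varepsilon$ for all $|k|>N$. *)

theory Defs
  imports "HOL-Analysis.Analysis"
begin

text \<open>
  Conventions. Steps \<open>j\<close> are numbered from 0, so \<open>h 0\<close> is the initial height; the columns at step
  \<open>j\<close> are numbered \<open>1, \<dots>, r j\<close>. All intervals are closed on the left and open on the right, and a
  base is cut from left to right. With this choice, if \<open>r j \<ge> 2\<close> for infinitely many \<open>j\<close>, every
  point of \<open>X\<close> lies below the top level of some tower, so \<open>T\<close> is determined on all of \<open>X\<close> and
  injective there; but the left endpoint of the first base has no preimage, so \<open>T\<close> is invertible
  on \<open>X\<close> up to a null set only. The values of \<open>T\<close> outside \<open>X\<close> are irrelevant.
\<close>

definition tower :: "(nat \<Rightarrow> nat) \<Rightarrow> (nat \<Rightarrow> real set) \<Rightarrow> (real \<Rightarrow> real) \<Rightarrow> nat \<Rightarrow> real set" where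
  "tower h E T j = (\<Union>n\<in>{0..h j}. (T ^^ n) ` E j)"

definition column ::
  "(nat \<Rightarrow> nat) \<Rightarrow> (nat \<Rightarrow> nat \<Rightarrow> real set) \<Rightarrow> (real \<Rightarrow> real) \<Rightarrow> nat \<Rightarrow> nat \<Rightarrow> real set" where
  "column h Ec T j i = (\<Union>n\<in>{0..h j}. (T ^^ n) ` Ec j i)"

text \<open>
  \<open>E j\<close> is the base of the \<open>j\<close>-th tower and \<open>Ec j i\<close> is the base of its \<open>i\<close>-th column.
  On each level below the top one \<open>T\<close> is a translation, so all levels of a tower are intervals of
  the same length. That the spacers \<open>(T ^^ (h j + k)) ` Ec j i\<close>, \<open>1 \<le> k \<le> s j i\<close>, are new, i.e.
  disjoint from each other and from the \<open>j\<close>-th tower, is the disjointness of the levels of the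
  tower \<open>Suc j\<close>, which consists of these spacers and the levels of the columns.
\<close>

locale rank_one_construction =
  fixes h r :: "nat \<Rightarrow> nat"
    and s :: "nat \<Rightarrow> nat \<Rightarrow> nat"
    and E :: "nat \<Rightarrow> real set"
    and Ec :: "nat \<Rightarrow> nat \<Rightarrow> real set"
    and X :: "real set"
    and T :: "real \<Rightarrow> real"
  assumes cuttings_pos: "r j \<ge> 1"
    and height_Suc: "h (Suc j) + 1 = (h j + 1) * r j + (\<Sum>i=1..r j. s j i)"
    and cut_base: "\<exists>a w. w > 0 \<and> E j = {a..<a + w} \<and>
          (\<forall>i\<in>{1..r j}. Ec j i =
             {a + (real i - 1) * (w / real (r j))..<a + real i * (w / real (r j))})"
    and base_Suc: "E (Suc j) = Ec j 1"
    and levels_disjoint: "disjoint_family_on (\<lambda>n. (T ^^ n) ` E j) {0..h j}"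
    and level_translation: "n < h j \<Longrightarrow> \<exists>c. \<forall>x\<in>(T ^^ n) ` E j. T x = x + c"
    and stack: "1 \<le> i \<Longrightarrow> i < r j \<Longrightarrow> T ` ((T ^^ (h j + s j i)) ` Ec j i) = Ec j (Suc i)"
    and space_eq: "X = (\<Union>j. tower h E T j)"

definition sidon_construction ::
  "(nat \<Rightarrow> nat) \<Rightarrow> (nat \<Rightarrow> nat) \<Rightarrow> (nat \<Rightarrow> real set) \<Rightarrow> (nat \<Rightarrow> nat \<Rightarrow> real set) \<Rightarrow>
    (real \<Rightarrow> real) \<Rightarrow> bool" where
  "sidon_construction h r E Ec T \<longleftrightarrow>
    (\<forall>j m. h j < m \<and> m < h (Suc j) \<longrightarrow>
      (\<exists>i\<in>{1..r j}. tower h E T j \<inter> (T ^^ m) ` tower h E T j \<subseteq> column h Ec T j i))"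

text \<open>
  The set \<open>T\<^sup>k A\<close> for an integer \<open>k\<close>. Negative powers are taken as preimages because \<open>T\<close> need
  only be invertible up to a null set.
\<close>

definition power_image :: "'a measure \<Rightarrow> ('a \<Rightarrow> 'a) \<Rightarrow> int \<Rightarrow> 'a set \<Rightarrow> 'a set" where
  "power_image M T k A =
    (if k \<ge> 0 then (T ^^ nat k) ` A else (T ^^ nat (- k)) -` A \<inter> space M)"

definition infinite_mixing :: "'a measure \<Rightarrow> ('a \<Rightarrow> 'a) \<Rightarrow> bool" where
  "infinite_mixing M T \<longleftrightarrow>
    (\<forall>\<epsilon>::real. \<forall>A\<in>sets M. \<forall>B\<in>sets M.
      \<epsilon> > 0 \<and> emeasure M A < \<infinity> \<and> emeasure M B < \<infinity> \<longrightarrow>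
      (\<exists>N::int. \<forall>k::int. \<bar>k\<bar> > N \<longrightarrow> emeasure M (power_image M T k A \<inter> B) < ennreal \<epsilon>))"

end

theory Submission
  imports Defs
begin

text \<open>
  Write \<open>U\<^sub>j\<close> for the \<open>j\<close>-th tower and \<open>w\<^sub>j\<close> for the common length of its levels. The towers
  increase to \<open>X\<close>, so two sets \<open>A\<close>, \<open>B\<close> of finite measure are contained in some \<open>U\<^sub>p\<close> up to small
  sets (\<open>tower_exhausts\<close>), and mixing reduces to \<open>\<mu>(U\<^sub>p \<inter> T\<^sup>m U\<^sub>p) \<rightarrow> 0\<close> for each fixed \<open>p\<close>.

  Given a large \<open>m\<close>, pick \<open>j\<close> with \<open>h\<^sub>j \<le> m < h\<^sub>j\<^sub>+\<^sub>1\<close>. If \<open>h\<^sub>j < m\<close>, the Sidon property puts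
  \<open>U\<^sub>p \<inter> T\<^sup>m U\<^sub>p \<subseteq> U\<^sub>j \<inter> T\<^sup>m U\<^sub>j\<close> into one column of \<open>U\<^sub>j\<close>. As \<open>U\<^sub>p\<close> is a union of levels of
  \<open>U\<^sub>j\<close>, each of which is cut into \<open>r\<^sub>j\<close> equal pieces by the columns, it meets a column in
  measure \<open>\<mu>(U\<^sub>p) / r\<^sub>j\<close> only (\<open>emeasure_tower_Int_column\<close>). The Sidon property is silent about
  \<open>m = h\<^sub>j\<close>, but it covers \<open>m + 1\<close>: if \<open>x \<in> T\<^sup>m U\<^sub>j\<close> is in \<open>U\<^sub>j\<close> below the top level, then
  \<open>T x\<close> is in \<open>U\<^sub>j \<inter> T\<^sup>m\<^sup>+\<^sup>1 U\<^sub>j\<close>, so \<open>T x\<close>, and with it \<open>x\<close>, lies in one fixed column. Hence in all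
  cases \<open>\<mu>(U\<^sub>p \<inter> T\<^sup>m U\<^sub>p) \<le> \<mu>(U\<^sub>p) / r\<^sub>j + w\<^sub>j\<close> (\<open>sidon_inter_subset\<close>, \<open>tower_return_small\<close>),
  which tends to 0 because \<open>r\<^sub>j \<rightarrow> \<infinity>\<close>.

  The reduction to towers, and the passage from negative to positive powers, need that \<open>T\<close> maps
  \<open>X\<close> injectively into itself and preserves the measure of images (\<open>T_image_measure\<close>). This
  follows from \<open>below_top_exists\<close>: each point of \<open>X\<close> is eventually below the top level, where \<open>T\<close>
  acts as a translation from one level to the next.
\<close>

section \<open>Levels and columns\<close>

context rank_one_construction
begin

definition level :: "nat \<Rightarrow> nat \<Rightarrow> real set" where
  "level j n = (T ^^ n) ` E j"

definition width :: "nat \<Rightarrow> real" where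
  "width j = measure lebesgue (E j)"

text \<open>
  The height at which the base of the \<open>i\<close>-th column of tower \<open>j\<close> occurs in tower \<open>Suc j\<close>; see
  \<open>column_base_eq\<close>.
\<close>

definition offset :: "nat \<Rightarrow> nat \<Rightarrow> nat" where
  "offset j i = (\<Sum>k=1..<i. h j + 1 + s j k)"

lemma cut_base_width: "\<exists>a. E j = {a..<a + width j} \<and> (\<forall>i\<in>{1..r j}.
    Ec j i = {a + (real i - 1) * (width j / real (r j))..<a + real i * (width j / real (r j))})"
proof -
  obtain a w where "w > 0" and E: "E j = {a..<a + w}"
    and Ec: "\<forall>i\<in>{1..r j}. Ec j i =
      {a + (real i - 1) * (w / real (r j))..<a + real i * (w / real (r j))}"
    using cut_base[of j] by blast
  then have "width j = w" by (simp add: width_def)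
  with E Ec show ?thesis by blast
qed

lemma width_pos: "width j > 0"
proof -
  obtain a w where "w > 0" and E: "E j = {a..<a + w}"
    using cut_base[of j] by blast
  then show ?thesis by (simp add: width_def)
qed

lemma width_Suc: "width (Suc j) = width j / real (r j)"
proof -
  obtain a where "E j = {a..<a + width j}" and a: "\<forall>i\<in>{1..r j}.
      Ec j i = {a + (real i - 1) * (width j / real (r j))..<a + real i * (width j / real (r j))}"
    using cut_base_width[of j] by blast
  have "1 \<in> {1..r j}" using cuttings_pos[of j] by simp
  from a[rule_format, OF this] have "E (Suc j) = {a..<a + width j / real (r j)}"
    by (simp add: base_Suc)
  moreover have "width j / real (r j) \<ge> 0" using width_pos[of j] by simp
  ultimately show ?thesis by (simp add: width_def[of "Suc j"])
qed

lemma base_eq_Union: "E j = (\<Union>i\<in>{1..r j}. Ec j i)"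
proof -
  obtain a where E: "E j = {a..<a + width j}" and
    Ec: "\<forall>i\<in>{1..r j}.
      Ec j i = {a + (real i - 1) * (width j / real (r j))..<a + real i * (width j / real (r j))}"
    using cut_base_width[of j] by blast
  define d where "d = width j / real (r j)"
  have rpos: "real (r j) \<ge> 1" using cuttings_pos[of j] by simp
  have d: "d > 0" "width j = real (r j) * d"
    using width_pos[of j] rpos by (auto simp: d_def)
  show ?thesis
  proof (rule set_eqI)
    fix x
    show "x \<in> E j \<longleftrightarrow> x \<in> (\<Union>i\<in>{1..r j}. Ec j i)"
    proof
      assume x: "x \<in> E j"
      \<comment> \<open>Columns are numbered from 1, hence the shift.\<close>
      define i where "i = nat \<lfloor>(x - a) / d\<rfloor> + 1"
      have pos: "(x - a) / d \<ge> 0" using x E d by simp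
      then have ri: "real i - 1 = real_of_int \<lfloor>(x - a) / d\<rfloor>" by (simp add: i_def)
      have lo: "real i - 1 \<le> (x - a) / d" and up: "(x - a) / d < real i"
        using ri by linarith+
      have "(x - a) / d < real (r j)" using x E d by (simp add: field_simps)
      then have "real i < real (r j) + 1" using lo by linarith
      then have i: "i \<in> {1..r j}" by (simp add: i_def)
      have "x \<in> Ec j i"
        using lo up d(1) Ec[rule_format, OF i] by (simp add: d_def[symmetric] field_simps)
      then show "x \<in> (\<Union>i\<in>{1..r j}. Ec j i)" using i by blast
    next
      assume "x \<in> (\<Union>i\<in>{1..r j}. Ec j i)"
      then obtain i where i: "i \<in> {1..r j}" and x: "x \<in> Ec j i" by blast
      have "a + (real i - 1) * d \<le> x" "x < a + real i * d"
        using x Ec[rule_format, OF i] by (auto simp: d_def)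
      moreover have "(real i - 1) * d \<ge> 0" using i d by simp
      moreover have "real i * d \<le> real (r j) * d" using i d by simp
      ultimately show "x \<in> E j" using E d(2) by simp
    qed
  qed
qed

lemma funpow_translation: "n \<le> h j \<Longrightarrow> \<exists>c. \<forall>x\<in>E j. (T ^^ n) x = x + c"
proof (induction n)
  case 0
  show ?case by (rule exI[of _ 0]) simp
next
  case (Suc n)
  then obtain c where c: "\<forall>x\<in>E j. (T ^^ n) x = x + c" by auto
  obtain d where d: "\<forall>x\<in>(T ^^ n) ` E j. T x = x + d"
    using level_translation[of n j] Suc.prems by auto
  have "\<forall>x\<in>E j. (T ^^ Suc n) x = x + (c + d)"
    using c d by (auto simp: algebra_simps)
  then show ?case by blast
qed

lemma image_eq_translation:
  fixes f :: "real \<Rightarrow> real"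
  assumes "\<forall>x\<in>S. f x = x + c" "A \<subseteq> S"
  shows "f ` A = (+) c ` A"
  using assms by (intro image_cong) (auto simp: add.commute)

lemma level_interval:
  assumes "n \<le> h j"
  obtains c where "level j n = {c..<c + width j}"
proof -
  obtain c where c: "\<forall>x\<in>E j. (T ^^ n) x = x + c" using funpow_translation[OF assms] by blast
  obtain a where E: "E j = {a..<a + width j}"
    using cut_base_width[of j] by blast
  have "level j n = (+) c ` {a..<a + width j}"
    using image_eq_translation[OF c subset_refl] E by (simp add: level_def)
  also have "\<dots> = {(c + a)..<(c + a) + width j}" by (simp add: algebra_simps)
  finally show ?thesis by (rule that)
qed

lemma emeasure_column_level:
  assumes "n \<le> h j" "i \<in> {1..r j}"
  shows "(T ^^ n) ` Ec j i \<in> sets lebesgue"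
    and "emeasure lebesgue ((T ^^ n) ` Ec j i) = ennreal (width j / real (r j))"
proof -
  obtain c where c: "\<forall>x\<in>E j. (T ^^ n) x = x + c"
    using funpow_translation[OF assms(1)] by blast
  obtain a where "E j = {a..<a + width j}" and
    Ec: "\<forall>i\<in>{1..r j}.
      Ec j i = {a + (real i - 1) * (width j / real (r j))..<a + real i * (width j / real (r j))}"
    using cut_base_width[of j] by blast
  have "Ec j i \<subseteq> E j" using base_eq_Union assms(2) by blast
  from image_eq_translation[OF c this]
  have *: "(T ^^ n) ` Ec j i = {c + (a + (real i - 1) * (width j / real (r j)))..<
      c + (a + real i * (width j / real (r j)))}"
    by (simp add: Ec[rule_format, OF assms(2)] add_ac)
  show "(T ^^ n) ` Ec j i \<in> sets lebesgue" by (simp add: *)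
  have "width j / real (r j) \<ge> 0" using width_pos[of j] by simp
  then have "c + (a + (real i - 1) * (width j / real (r j))) \<le>
      c + (a + real i * (width j / real (r j)))"
    using \<open>width j / real (r j) \<ge> 0\<close> by (intro add_left_mono mult_right_mono) auto
  then show "emeasure lebesgue ((T ^^ n) ` Ec j i) = ennreal (width j / real (r j))"
    by (simp add: * algebra_simps diff_divide_distrib)
qed

lemma level_measurable: "n \<le> h j \<Longrightarrow> level j n \<in> sets lebesgue"
  by (rule level_interval[of n j]) simp_all

lemma emeasure_level: "n \<le> h j \<Longrightarrow> emeasure lebesgue (level j n) = ennreal (width j)"
  using width_pos[of j] by - (rule level_interval[of n j], simp_all)

lemma level_disjoint:
  assumes "x \<in> level j n" "x \<in> level j n'" "n \<le> h j" "n' \<le> h j"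
  shows "n = n'"
  using levels_disjoint[of j] assms unfolding disjoint_family_on_def level_def
  by (metis atLeastAtMost_iff disjoint_iff zero_le)

lemma offset_Suc: "i \<ge> 1 \<Longrightarrow> offset j (Suc i) = offset j i + h j + 1 + s j i"
  by (simp add: offset_def)

lemma offset_le:
  assumes "i \<in> {1..r j}"
  shows "offset j i + h j + s j i \<le> h (Suc j)"
proof -
  have "offset j (Suc i) = (\<Sum>k=1..i. h j + 1 + s j k)"
    by (simp add: offset_def atLeastLessThanSuc_atLeastAtMost)
  also have "\<dots> \<le> (\<Sum>k=1..r j. h j + 1 + s j k)"
    using assms by (intro sum_mono2) auto
  also have "\<dots> = h (Suc j) + 1" using height_Suc[of j] by (simp only: sum.distrib sum_constant card_atLeastAtMost) (simp add: algebra_simps)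
  finally show ?thesis using assms by (simp add: offset_Suc)
qed

lemma column_base_eq: "1 \<le> i \<Longrightarrow> i \<le> r j \<Longrightarrow> Ec j i = level (Suc j) (offset j i)"
proof (induction i rule: nat_induct_at_least)
  case base
  then show ?case by (simp add: level_def offset_def base_Suc)
next
  case (Suc i)
  have "Ec j (Suc i) = T ` ((T ^^ (h j + s j i)) ` Ec j i)"
    using Suc stack[of i j] by simp
  also have "\<dots> = T ` ((T ^^ (h j + s j i)) ` ((T ^^ offset j i) ` E (Suc j)))"
    using Suc by (simp add: level_def)
  also have "\<dots> = (T ^^ (Suc (h j + s j i) + offset j i)) ` E (Suc j)"
    by (simp add: image_image funpow_add)
  also have "Suc (h j + s j i) + offset j i = offset j (Suc i)"
    using Suc by (simp add: offset_Suc)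
  finally show ?case by (simp add: level_def)
qed

lemma column_level_eq:
  "i \<in> {1..r j} \<Longrightarrow> (T ^^ n) ` Ec j i = level (Suc j) (offset j i + n)"
  using column_base_eq[of i j]
  by (simp add: level_def image_image funpow_add add.commute[of "offset j i" n])

text \<open>
  The columns of tower \<open>j\<close> are stacked to form tower \<open>Suc j\<close>, so a level of the former breaks
  into one level of the latter for each column. This is why the towers increase and why an early
  tower is a union of full levels of every later one.
\<close>

lemma level_split: "level j n = (\<Union>i\<in>{1..r j}. level (Suc j) (offset j i + n))"
proof -
  have "level j n = (\<Union>i\<in>{1..r j}. (T ^^ n) ` Ec j i)"
    by (simp add: level_def base_eq_Union[of j] image_UN)
  then show ?thesis using column_level_eq by simp
qed

lemma tower_eq: "tower h E T j = (\<Union>n\<in>{..h j}. level j n)"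
  by (auto simp: tower_def level_def)

lemma tower_eq_levels:
  assumes "p \<le> j"
  shows "\<exists>N\<subseteq>{..h j}. tower h E T p = (\<Union>n\<in>N. level j n)"
  using assms
proof (induction j rule: dec_induct)
  case base
  show ?case using tower_eq by blast
next
  case (step j)
  then obtain N where N: "N \<subseteq> {..h j}" "tower h E T p = (\<Union>n\<in>N. level j n)" by blast
  let ?N = "(\<lambda>(n, i). offset j i + n) ` (N \<times> {1..r j})"
  have "?N \<subseteq> {..h (Suc j)}"
  proof clarsimp
    fix n i assume *: "n \<in> N" "Suc 0 \<le> i" "i \<le> r j"
    then have "n \<le> h j" using N by auto
    then show "offset j i + n \<le> h (Suc j)" using offset_le[of i j] * by simp
  qed
  moreover have "tower h E T p = (\<Union>n\<in>?N. level (Suc j) n)"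
    unfolding N(2) level_split[of j] by auto
  ultimately show ?case by blast
qed

lemma tower_mono: "p \<le> j \<Longrightarrow> tower h E T p \<subseteq> tower h E T j"
  using tower_eq_levels[of p j] tower_eq[of j] by blast

lemma tower_subset_space: "tower h E T j \<subseteq> X"
  by (auto simp: space_eq)

lemma tower_measurable: "tower h E T j \<in> sets lebesgue"
  unfolding tower_eq by (intro sets.finite_UN level_measurable) auto

lemma space_measurable: "X \<in> sets lebesgue"
  unfolding space_eq by (intro sets.countable_UN) (auto simp: tower_measurable)

text \<open>
  A column takes the fraction \<open>1 / r j\<close> of every level of tower \<open>j\<close>, and tower \<open>p\<close> is a disjoint
  union of such levels.
\<close>

lemma emeasure_tower_Int_column:
  assumes "p \<le> j" "i \<in> {1..r j}"
  shows "emeasure lebesgue (tower h E T p \<inter> column h Ec T j i)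
    \<le> emeasure lebesgue (tower h E T p) / of_nat (r j)"
proof -
  obtain N where N: "N \<subseteq> {..h j}" "tower h E T p = (\<Union>n\<in>N. level j n)"
    using tower_eq_levels[OF assms(1)] by blast
  have fin: "finite N" using N(1) finite_subset by blast
  have sub: "(T ^^ n) ` Ec j i \<subseteq> level j n" for n
    using base_eq_Union[of j] assms(2) unfolding level_def by blast
  have "tower h E T p \<inter> column h Ec T j i \<subseteq> (\<Union>n\<in>N. (T ^^ n) ` Ec j i)"
  proof
    fix x assume x: "x \<in> tower h E T p \<inter> column h Ec T j i"
    then obtain n where n: "n \<in> N" "x \<in> level j n" using N by auto
    obtain n' where n': "n' \<le> h j" "x \<in> (T ^^ n') ` Ec j i"
      using x by (auto simp: column_def)
    \<comment> \<open>A column cannot meet a level of the tower at a different height.\<close>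
    have "n = n'" using level_disjoint[of x j n n'] n n' N(1) sub by blast
    then show "x \<in> (\<Union>n\<in>N. (T ^^ n) ` Ec j i)" using n n' by blast
  qed
  then have "emeasure lebesgue (tower h E T p \<inter> column h Ec T j i)
      \<le> emeasure lebesgue (\<Union>n\<in>N. (T ^^ n) ` Ec j i)"
    using N(1) fin emeasure_column_level(1)[OF _ assms(2)]
    by (intro emeasure_mono sets.finite_UN) auto
  also have "\<dots> \<le> (\<Sum>n\<in>N. emeasure lebesgue ((T ^^ n) ` Ec j i))"
    using N(1) fin emeasure_column_level(1)[OF _ assms(2)]
    by (intro emeasure_subadditive_finite) auto
  also have "\<dots> = (\<Sum>n\<in>N. ennreal (width j / real (r j)))"
    using N(1) emeasure_column_level(2)[OF _ assms(2)] by (intro sum.cong) auto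
  also have "\<dots> = (\<Sum>n\<in>N. ennreal (width j)) / of_nat (r j)"
    using cuttings_pos[of j] width_pos[of j]
    by (simp add: divide_ennreal[symmetric] ennreal_times_divide ennreal_of_nat_eq_real_of_nat)
  also have "(\<Sum>n\<in>N. ennreal (width j)) = (\<Sum>n\<in>N. emeasure lebesgue (level j n))"
    using N(1) emeasure_level by (intro sum.cong) auto
  also have "\<dots> = emeasure lebesgue (tower h E T p)"
    unfolding N(2)
  proof (intro sum_emeasure)
    show "level j ` N \<subseteq> sets lebesgue" using N(1) level_measurable by auto
    show "disjoint_family_on (level j) N"
      using N(1) level_disjoint unfolding disjoint_family_on_def by blast
  qed (rule fin)
  finally show ?thesis .
qed

section \<open>Points below the top level\<close>

lemma width_le: "width j \<le> width 0"
proof (induction j)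
  case (Suc j)
  have "width j / real (r j) \<le> width j"
    using width_pos[of j] cuttings_pos[of j] by (simp add: field_simps)
  with Suc show ?case by (simp add: width_Suc)
qed simp

text \<open>
  Already the last cut makes the levels short: \<open>width (Suc j) = width j / r j\<close>, and the widths
  stay below the initial one.
\<close>

lemma width_tendsto_zero:
  assumes "filterlim r at_top sequentially"
  shows "width \<longlonglongrightarrow> 0"
proof (rule LIMSEQ_imp_Suc, rule tendsto_sandwich[of "\<lambda>_. 0"])
  show "(\<lambda>j. width 0 / real (r j)) \<longlonglongrightarrow> 0"
    using filterlim_compose[OF filterlim_real_sequentially assms]
    by (intro tendsto_divide_0[OF tendsto_const] filterlim_at_top_imp_at_infinity)
  show "\<forall>\<^sub>F j in sequentially. width (Suc j) \<le> width 0 / real (r j)"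
    using width_le by (intro always_eventually allI) (simp add: width_Suc divide_right_mono)
  show "\<forall>\<^sub>F j in sequentially. 0 \<le> width (Suc j)"
    using width_pos by (intro always_eventually allI less_imp_le)
qed simp

text \<open>
  A point that stays on the top level when passing to the next tower must lie in the last column,
  with no spacers above it. The new top level is then the rightmost piece of the old one, so that
  the right end point does not change.
\<close>

lemma top_level_right_end:
  assumes top: "level j (h j) = {b - width j..<b}"
    and x: "x \<in> level j (h j)" "x \<notin> (\<Union>n\<in>{..<h (Suc j)}. level (Suc j) n)"
  shows "level (Suc j) (h (Suc j)) = {b - width (Suc j)..<b}" and "x \<in> level (Suc j) (h (Suc j))"
proof -
  obtain i where i: "i \<in> {1..r j}" and xi: "x \<in> level (Suc j) (offset j i + h j)"
    using x(1) level_split[of j "h j"] by blast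
  have le: "offset j i + h j \<le> h (Suc j)" using offset_le[OF i] by simp
  have eq: "offset j i + h j = h (Suc j)"
  proof (rule ccontr)
    assume "\<not> ?thesis"
    then have "offset j i + h j < h (Suc j)" using le by simp
    then show False using x(2) xi by auto
  qed
  have "i = r j"
  proof (rule ccontr)
    assume "i \<noteq> r j"
    then have i': "Suc i \<in> {1..r j}" using i by simp
    show False using offset_le[OF i'] eq i by (simp add: offset_Suc)
  qed
  show "x \<in> level (Suc j) (h (Suc j))" using xi eq by simp
  obtain c where c: "\<forall>x\<in>E j. (T ^^ h j) x = x + c" using funpow_translation[of "h j"] by blast
  obtain a where E: "E j = {a..<a + width j}" and
    Ec: "\<forall>i\<in>{1..r j}.
      Ec j i = {a + (real i - 1) * (width j / real (r j))..<a + real i * (width j / real (r j))}"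
    using cut_base_width[of j] by blast
  have "level j (h j) = {c + a..<c + a + width j}"
    using image_eq_translation[OF c subset_refl] by (simp add: level_def E algebra_simps)
  then have b: "b = c + a + width j"
    using top width_pos[of j] by (metis Ico_eq_Ico diff_less_eq less_add_same_cancel1)
  have "level (Suc j) (h (Suc j)) = (T ^^ h j) ` Ec j i"
    using column_level_eq[OF i, of "h j"] eq by simp
  also have "\<dots> = (+) c ` Ec j i"
    using base_eq_Union[of j] i by (intro image_eq_translation[OF c]) blast
  also have "Ec j i = {a + width j - width (Suc j)..<a + width j}"
    using cuttings_pos[of j] width_pos[of j]
    unfolding \<open>i = r j\<close> Ec[rule_format, OF i, unfolded \<open>i = r j\<close>]
    by (simp add: width_Suc left_diff_distrib diff_divide_distrib add_diff_eq)
  also have "(+) c ` \<dots> = {b - width (Suc j)..<b}"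
    by (simp add: b add_ac add_diff_eq)
  finally show "level (Suc j) (h (Suc j)) = {b - width (Suc j)..<b}" .
qed

text \<open>
  A point that is always on the top level would lie in a nested sequence of half-open intervals with
  the same right end point and lengths tending to 0; these have an empty intersection because the
  right end point is excluded.
\<close>

lemma below_top_exists:
  assumes lim: "filterlim r at_top sequentially" and "x \<in> X"
  shows "\<exists>j. \<exists>n<h j. x \<in> level j n"
proof (rule ccontr)
  assume neg: "\<not> ?thesis"
  obtain p where "x \<in> tower h E T p" using assms(2) by (auto simp: space_eq)
  then have xp: "x \<in> level p (h p)"
    using neg unfolding tower_eq by (auto simp: le_less)
  obtain c where c: "level p (h p) = {c..<c + width p}"
    by (rule level_interval[of "h p" p]) simp_all
  define b where "b = c + width p"
  have inv: "level j (h j) = {b - width j..<b} \<and> x \<in> level j (h j)" if "p \<le> j" for j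
    using that
  proof (induction j rule: dec_induct)
    case base
    show ?case using c xp by (simp add: b_def)
  next
    case (step j)
    then show ?case using top_level_right_end[of j b x] neg by blast
  qed
  have "x < b" using inv[of p] by auto
  then have "\<forall>\<^sub>F j in sequentially. width j < b - x"
    using order_tendstoD(2)[OF width_tendsto_zero[OF lim]] by simp
  then have "\<forall>\<^sub>F j in sequentially. width j < b - x \<and> p \<le> j"
    by (intro eventually_conj eventually_ge_at_top)
  then obtain j where "width j < b - x" "p \<le> j"
    using eventually_happens' sequentially_bot by blast
  moreover have "b - width j \<le> x" using inv[OF \<open>p \<le> j\<close>] by auto
  ultimately show False by simp
qed

definition below_top :: "nat \<Rightarrow> real set" where
  "below_top j = (\<Union>n\<in>{..<h j}. level j n)"

lemma below_top_Suc: "below_top j \<subseteq> below_top (Suc j)"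
proof
  fix x assume "x \<in> below_top j"
  then obtain n where n: "n < h j" "x \<in> level j n" by (auto simp: below_top_def)
  then obtain i where i: "i \<in> {1..r j}" and xi: "x \<in> level (Suc j) (offset j i + n)"
    using level_split[of j n] by blast
  have "offset j i + n < h (Suc j)" using offset_le[OF i] n by simp
  then show "x \<in> below_top (Suc j)" using xi by (auto simp: below_top_def)
qed

lemma incseq_below_top: "incseq below_top"
  using below_top_Suc by (rule incseq_SucI)

lemma below_top_subset: "below_top j \<subseteq> tower h E T j"
  unfolding below_top_def tower_eq by (intro UN_mono) auto

lemma Union_below_top:
  assumes "filterlim r at_top sequentially"
  shows "(\<Union>j. below_top j) = X"
proof
  show "(\<Union>j. below_top j) \<subseteq> X"
    using below_top_subset tower_subset_space by blast
  show "X \<subseteq> (\<Union>j. below_top j)"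
    using below_top_exists[OF assms] unfolding below_top_def by blast
qed

section \<open>The transformation is injective and measure preserving\<close>

lemma T_level: "x \<in> level j n \<Longrightarrow> T x \<in> level j (Suc n)"
  by (auto simp: level_def)

lemma T_in_tower: "x \<in> below_top j \<Longrightarrow> T x \<in> tower h E T j"
  unfolding below_top_def tower_eq using T_level by (metis (no_types, lifting) UN_iff Suc_leI atMost_iff lessThan_iff)

text \<open>
  \<open>T\<close> moves distinct levels below the top to distinct levels and is injective on each of them.
\<close>

lemma inj_on_below_top: "inj_on T (below_top j)"
proof (rule inj_onI)
  fix x y assume "x \<in> below_top j" "y \<in> below_top j" and eq: "T x = T y"
  then obtain n m where n: "n < h j" "x \<in> level j n" and m: "m < h j" "y \<in> level j m"
    by (auto simp: below_top_def)
  have "Suc n = Suc m"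
    using level_disjoint[of "T x" j "Suc n" "Suc m"] T_level[OF n(2)] T_level[OF m(2)] eq n m by simp
  then have "y \<in> level j n" using m by simp
  then show "x = y" using level_translation[OF n(1)] n(2) eq by (auto simp: level_def)
qed

lemma T_image_below_top:
  assumes "A \<in> sets lebesgue" "A \<subseteq> below_top j"
  shows "T ` A \<in> sets lebesgue" and "emeasure lebesgue (T ` A) = emeasure lebesgue A"
proof -
  have piece: "T ` (A \<inter> level j n) \<in> sets lebesgue
      \<and> emeasure lebesgue (T ` (A \<inter> level j n)) = emeasure lebesgue (A \<inter> level j n)"
    if n: "n < h j" for n
  proof -
    obtain c where c: "\<forall>x\<in>level j n. T x = x + c"
      using level_translation[OF n] unfolding level_def by blast
    have eq: "T ` (A \<inter> level j n) = (+) c ` (A \<inter> level j n)"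
      by (rule image_eq_translation[OF c]) simp
    have m: "A \<inter> level j n \<in> sets lebesgue" using assms(1) level_measurable n by auto
    show ?thesis
      unfolding eq using lebesgue_sets_translation[OF m, of c] emeasure_lebesgue_affine[of 1 c "A \<inter> level j n"] m
      by (simp add: add.commute[of c] del: emeasure_completion)
  qed
  have A: "A = (\<Union>n\<in>{..<h j}. A \<inter> level j n)" using assms(2) by (auto simp: below_top_def)
  then have TA: "T ` A = (\<Union>n\<in>{..<h j}. T ` (A \<inter> level j n))" by blast
  show "T ` A \<in> sets lebesgue"
    unfolding TA using piece by (intro sets.finite_UN) auto
  have disj: "disjoint_family_on (\<lambda>n. A \<inter> level j n) {..<h j}"
    using level_disjoint unfolding disjoint_family_on_def
    by (metis Int_iff disjoint_iff lessThan_iff less_imp_le)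
  have disjT: "disjoint_family_on (\<lambda>n. T ` (A \<inter> level j n)) {..<h j}"
    unfolding disjoint_family_on_def
  proof (intro ballI impI)
    fix m n assume mn: "m \<in> {..<h j}" "n \<in> {..<h j}" "m \<noteq> n"
    have "T ` (A \<inter> level j m) \<inter> T ` (A \<inter> level j n)
        = T ` ((A \<inter> level j m) \<inter> (A \<inter> level j n))"
      using assms(2) by (intro inj_on_image_Int[OF inj_on_below_top[of j], symmetric]) auto
    also have "\<dots> = {}" using disj mn unfolding disjoint_family_on_def by blast
    finally show "T ` (A \<inter> level j m) \<inter> T ` (A \<inter> level j n) = {}" .
  qed
  have "emeasure lebesgue (T ` A) = (\<Sum>n\<in>{..<h j}. emeasure lebesgue (T ` (A \<inter> level j n)))"
    unfolding TA using piece disjT by (intro sum_emeasure[symmetric]) auto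
  also have "\<dots> = (\<Sum>n\<in>{..<h j}. emeasure lebesgue (A \<inter> level j n))"
    using piece by (simp del: emeasure_completion)
  also have "\<dots> = emeasure lebesgue (\<Union>n\<in>{..<h j}. A \<inter> level j n)"
    using assms(1) level_measurable disj by (intro sum_emeasure) auto
  finally show "emeasure lebesgue (T ` A) = emeasure lebesgue A" using A by simp
qed

lemma below_top_measurable: "below_top j \<in> sets lebesgue"
  unfolding below_top_def by (intro sets.finite_UN level_measurable) auto

text \<open>
  Since the sets \<open>below_top j\<close> increase to \<open>X\<close>, the claim for subsets of them passes to the limit.
\<close>

lemma T_image_measure:
  assumes lim: "filterlim r at_top sequentially"
    and A: "A \<in> sets lebesgue" "A \<subseteq> X"
  shows "T ` A \<in> sets lebesgue" and "emeasure lebesgue (T ` A) = emeasure lebesgue A"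
proof -
  let ?A = "\<lambda>j. A \<inter> below_top j"
  have m: "?A j \<in> sets lebesgue" for j using A below_top_measurable by auto
  note T = T_image_below_top[OF m, OF Int_lower2]
  have A_eq: "A = (\<Union>j. ?A j)" using A(2) Union_below_top[OF lim] by blast
  then have TA: "T ` A = (\<Union>j. T ` ?A j)" by blast
  show "T ` A \<in> sets lebesgue" unfolding TA using T(1) by (intro sets.countable_UN) auto
  have inc: "incseq ?A" using incseq_below_top by (auto simp: incseq_def)
  then have incT: "incseq (\<lambda>j. T ` ?A j)" by (simp add: incseq_def image_mono)
  have "emeasure lebesgue (T ` A) = (SUP j. emeasure lebesgue (T ` ?A j))"
    unfolding TA using T(1) incT by (intro SUP_emeasure_incseq[symmetric]) auto
  also have "\<dots> = (SUP j. emeasure lebesgue (?A j))" by (simp only: T(2))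
  also have "\<dots> = emeasure lebesgue (\<Union>j. ?A j)"
    using m inc by (intro SUP_emeasure_incseq) auto
  finally show "emeasure lebesgue (T ` A) = emeasure lebesgue A" using A_eq by simp
qed

lemma T_maps_space:
  assumes "filterlim r at_top sequentially" "A \<subseteq> X"
  shows "T ` A \<subseteq> X"
proof (rule image_subsetI)
  fix x assume "x \<in> A"
  then obtain j where "x \<in> below_top j" using Union_below_top[OF assms(1)] assms(2) by blast
  then show "T x \<in> X" using T_in_tower tower_subset_space by blast
qed

lemma funpow_image_measure:
  assumes lim: "filterlim r at_top sequentially"
    and A: "A \<in> sets lebesgue" "A \<subseteq> X"
  shows "(T ^^ m) ` A \<in> sets lebesgue \<and> (T ^^ m) ` A \<subseteq> X
    \<and> emeasure lebesgue ((T ^^ m) ` A) = emeasure lebesgue A"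
proof (induction m)
  case 0
  show ?case using A by simp
next
  case (Suc m)
  have "(T ^^ Suc m) ` A = T ` ((T ^^ m) ` A)" by (simp add: image_image)
  then show ?case using Suc T_image_measure[OF lim] T_maps_space[OF lim] by metis
qed

section \<open>Returns of a tower to itself\<close>

text \<open>
  The bound 3 on the number of cuts makes room for the time \<open>h j + 1\<close> strictly between two
  consecutive heights, as \<open>sidon_inter_subset\<close> needs it.
\<close>

lemma height_lt:
  assumes "r j \<ge> 3"
  shows "h j + 1 < h (Suc j)"
proof -
  have "(h j + 1) * 3 \<le> (h j + 1) * r j" using assms by (rule mult_left_mono) simp
  then show ?thesis using height_Suc[of j] by simp
qed

text \<open>
  Heights are strictly increasing from stage \<open>J\<close> on, so the intervals between consecutive heights
  cover everything from \<open>h J\<close> upwards.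
\<close>

lemma stage_exists:
  assumes "\<And>j. J \<le> j \<Longrightarrow> r j \<ge> 3" "h J \<le> m"
  shows "\<exists>j\<ge>J. h j \<le> m \<and> m < h (Suc j)"
proof -
  have grow: "i \<le> h (J + i)" for i
  proof (induction i)
    case (Suc i)
    then show ?case using height_lt[OF assms(1), of "J + i"] by simp
  qed simp
  let ?P = "\<lambda>i. m < h (J + i)"
  have P: "?P (Suc m)" using grow[of "Suc m"] by simp
  define k where "k = (LEAST i. ?P i)"
  have k: "?P k" unfolding k_def using P by (rule LeastI)
  then have "k \<noteq> 0" using assms(2) by (metis add_0_right not_less)
  then obtain i where i: "k = Suc i" using not0_implies_Suc by blast
  then have "\<not> ?P i" unfolding k_def by (metis not_less_Least lessI)
  then show ?thesis using k i by (intro exI[of _ "J + i"]) auto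
qed

text \<open>
  For \<open>m > h j\<close> this is the Sidon property itself. For \<open>m = h j\<close> the
  property is used at time \<open>m + 1\<close> and transported back by one step of \<open>T\<close>, which is possible
  below the top level.
\<close>

lemma sidon_inter_subset:
  assumes sidon: "sidon_construction h r E Ec T"
    and "p \<le> j" "r j \<ge> 3" and m: "h j \<le> m" "m < h (Suc j)"
  obtains i where "i \<in> {1..r j}"
    and "tower h E T p \<inter> (T ^^ m) ` tower h E T p
      \<subseteq> (tower h E T p \<inter> column h Ec T j i) \<union> level j (h j)"
proof (cases "m = h j")
  case False
  then obtain i where i: "i \<in> {1..r j}"
      "tower h E T j \<inter> (T ^^ m) ` tower h E T j \<subseteq> column h Ec T j i"
    using sidon m unfolding sidon_construction_def by (metis le_neq_implies_less)
  show ?thesis using i tower_mono[OF assms(2)] by (intro that[OF i(1)]) blast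
next
  case True
  have "h j < Suc m" "Suc m < h (Suc j)" using True height_lt[OF assms(3)] by auto
  then obtain i where i: "i \<in> {1..r j}"
      "tower h E T j \<inter> (T ^^ Suc m) ` tower h E T j \<subseteq> column h Ec T j i"
    using sidon unfolding sidon_construction_def by blast
  show ?thesis
  proof (rule that[OF i(1)], rule subsetI)
    fix x assume x: "x \<in> tower h E T p \<inter> (T ^^ m) ` tower h E T p"
    then obtain n where n: "n \<le> h j" "x \<in> level j n"
      using tower_mono[OF assms(2)] tower_eq[of j] by blast
    show "x \<in> (tower h E T p \<inter> column h Ec T j i) \<union> level j (h j)"
    proof (cases "n = h j")
      case False
      then have xb: "x \<in> below_top j" using n by (auto simp: below_top_def)
      obtain y where "y \<in> tower h E T j" "x = (T ^^ m) y"
        using x tower_mono[OF assms(2)] by blast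
      then have "T x \<in> column h Ec T j i"
        using T_in_tower[OF xb] i(2) by auto
      then obtain n' e where e: "n' \<le> h j" "e \<in> Ec j i" "T x = (T ^^ n') e"
        by (auto simp: column_def)
      have eE: "e \<in> E j" using base_eq_Union[of j] e(2) i(1) by blast
      have "n' = Suc n"
        using level_disjoint[of "T x" j n' "Suc n"] e eE T_level[OF n(2)] n(1) False
        by (auto simp: level_def)
      then have "T x = T ((T ^^ n) e)" using e by simp
      moreover have "(T ^^ n) e \<in> below_top j"
        using eE n(1) False by (auto simp: below_top_def level_def)
      ultimately have "x = (T ^^ n) e" using xb inj_on_below_top inj_onD by metis
      then show ?thesis using x e(2) n(1) by (auto simp: column_def)
    qed (use n in simp)
  qed
qed

lemma tower_return_small:
  assumes lim: "filterlim r at_top sequentially"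
    and sidon: "sidon_construction h r E Ec T"
    and "\<epsilon> > 0"
  shows "\<exists>M. \<forall>m\<ge>M. emeasure lebesgue (tower h E T p \<inter> (T ^^ m) ` tower h E T p) < ennreal \<epsilon>"
proof -
  have fin: "emeasure lebesgue (tower h E T p) < \<infinity>"
  proof -
    have "emeasure lebesgue (tower h E T p) \<le> (\<Sum>n\<in>{..h p}. emeasure lebesgue (level p n))"
      unfolding tower_eq using level_measurable by (intro emeasure_subadditive_finite) auto
    also have "\<dots> = (\<Sum>n\<in>{..h p}. ennreal (width p))"
      by (intro sum.cong) (auto simp: emeasure_level)
    also have "\<dots> < \<infinity>" by (simp add: ennreal_mult_less_top of_nat_less_top)
    finally show ?thesis .
  qed
  define u where "u = measure lebesgue (tower h E T p)"
  have u: "emeasure lebesgue (tower h E T p) = ennreal u" "u \<ge> 0"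
    using fin by (auto simp: u_def emeasure_eq_ennreal_measure)
  have "(\<lambda>j. u / real (r j) + width j) \<longlonglongrightarrow> 0 + 0"
    using filterlim_compose[OF filterlim_real_sequentially lim]
    by (intro tendsto_add width_tendsto_zero[OF lim] tendsto_divide_0[OF tendsto_const]
        filterlim_at_top_imp_at_infinity)
  then have "\<forall>\<^sub>F j in sequentially. u / real (r j) + width j < \<epsilon>"
    using order_tendstoD(2) \<open>\<epsilon> > 0\<close> by fastforce
  moreover have "\<forall>\<^sub>F j in sequentially. r j \<ge> 3"
    using lim by (simp add: filterlim_at_top)
  ultimately have "\<forall>\<^sub>F j in sequentially. u / real (r j) + width j < \<epsilon> \<and> r j \<ge> 3 \<and> p \<le> j"
    using eventually_ge_at_top[of p] by eventually_elim simp
  then obtain J where J: "\<And>j. J \<le> j \<Longrightarrow> u / real (r j) + width j < \<epsilon> \<and> r j \<ge> 3 \<and> p \<le> j"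
    by (auto simp: eventually_sequentially)
  show ?thesis
  proof (intro exI allI impI)
    fix m assume "h J \<le> m"
    then obtain j where j: "J \<le> j" "h j \<le> m" "m < h (Suc j)" using stage_exists J by blast
    obtain i where i: "i \<in> {1..r j}"
      and sub: "tower h E T p \<inter> (T ^^ m) ` tower h E T p
        \<subseteq> (tower h E T p \<inter> column h Ec T j i) \<union> level j (h j)"
      using sidon_inter_subset[OF sidon] J[OF j(1)] j by blast
    have meas: "column h Ec T j i \<in> sets lebesgue"
      unfolding column_def using i
      by (intro sets.finite_UN emeasure_column_level) auto
    have "emeasure lebesgue (tower h E T p \<inter> (T ^^ m) ` tower h E T p)
        \<le> emeasure lebesgue ((tower h E T p \<inter> column h Ec T j i) \<union> level j (h j))"
      using sub meas tower_measurable level_measurable by (intro emeasure_mono) auto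
    also have "\<dots> \<le> emeasure lebesgue (tower h E T p \<inter> column h Ec T j i)
        + emeasure lebesgue (level j (h j))"
      using meas tower_measurable level_measurable by (intro emeasure_subadditive) auto
    also have "\<dots> \<le> ennreal u / of_nat (r j) + ennreal (width j)"
      using emeasure_tower_Int_column[OF _ i, of p] J[OF j(1)] u
      by (intro add_mono) (auto simp: emeasure_level)
    also have "\<dots> = ennreal (u / real (r j) + width j)"
      using u(2) width_pos[of j] cuttings_pos[of j]
      by (simp add: divide_ennreal ennreal_of_nat_eq_real_of_nat)
    also have "\<dots> < ennreal \<epsilon>" using J[OF j(1)] \<open>\<epsilon> > 0\<close> by (intro ennreal_lessI) auto
    finally show "emeasure lebesgue (tower h E T p \<inter> (T ^^ m) ` tower h E T p) < ennreal \<epsilon>" .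
  qed
qed

section \<open>From towers to sets of finite measure\<close>

lemma tower_exhausts:
  assumes "A \<in> sets lebesgue" "A \<subseteq> X" "emeasure lebesgue A < \<infinity>" "\<epsilon> > 0"
  shows "\<forall>\<^sub>F p in sequentially. emeasure lebesgue (A - tower h E T p) < ennreal \<epsilon>"
proof -
  have "(\<lambda>p. emeasure lebesgue (A - tower h E T p))
      \<longlonglongrightarrow> emeasure lebesgue (\<Inter>p. A - tower h E T p)"
  proof (rule Lim_emeasure_decseq)
    show "range (\<lambda>p. A - tower h E T p) \<subseteq> sets lebesgue" using assms(1) tower_measurable by auto
    show "decseq (\<lambda>p. A - tower h E T p)" using tower_mono by (fastforce simp: decseq_def)
    fix p
    have "emeasure lebesgue (A - tower h E T p) \<le> emeasure lebesgue A"
      using assms(1) by (intro emeasure_mono) auto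
    then show "emeasure lebesgue (A - tower h E T p) \<noteq> \<infinity>" using assms(3) by auto
  qed
  moreover have "(\<Inter>p. A - tower h E T p) = {}" using assms(2) unfolding space_eq by blast
  ultimately have "(\<lambda>p. emeasure lebesgue (A - tower h E T p)) \<longlonglongrightarrow> 0"
    by (simp only: emeasure_empty)
  then show ?thesis using order_tendstoD(2) assms(4) by fastforce
qed

text \<open>
  Outside \<open>U\<^sub>p\<close> both sets are small, and \<open>T ^^ m\<close> does not enlarge the part of \<open>A\<close> outside \<open>U\<^sub>p\<close>;
  what is left is the intersection of \<open>U\<^sub>p\<close> with its own image.
\<close>

lemma forward_mixing:
  assumes lim: "filterlim r at_top sequentially"
    and sidon: "sidon_construction h r E Ec T"
    and A: "A \<in> sets lebesgue" "A \<subseteq> X" "emeasure lebesgue A < \<infinity>"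
    and B: "B \<in> sets lebesgue" "B \<subseteq> X" "emeasure lebesgue B < \<infinity>"
    and "\<epsilon> > 0"
  shows "\<exists>M. \<forall>m\<ge>M. emeasure lebesgue ((T ^^ m) ` A \<inter> B) < ennreal \<epsilon>"
proof -
  define \<delta> where "\<delta> = \<epsilon> / 3"
  have \<delta>: "\<delta> > 0" using \<open>\<epsilon> > 0\<close> by (simp add: \<delta>_def)
  have "\<forall>\<^sub>F p in sequentially. emeasure lebesgue (A - tower h E T p) < ennreal \<delta>
      \<and> emeasure lebesgue (B - tower h E T p) < ennreal \<delta>"
    using tower_exhausts[OF A \<delta>] tower_exhausts[OF B \<delta>] by eventually_elim simp
  then obtain p where p: "emeasure lebesgue (A - tower h E T p) < ennreal \<delta>"
      "emeasure lebesgue (B - tower h E T p) < ennreal \<delta>"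
    by (auto simp: eventually_sequentially)
  let ?U = "tower h E T p"
  obtain M where M: "\<And>m. m \<ge> M \<Longrightarrow> emeasure lebesgue (?U \<inter> (T ^^ m) ` ?U) < ennreal \<delta>"
    using tower_return_small[OF lim sidon \<delta>, of p] by blast
  show ?thesis
  proof (intro exI allI impI)
    fix m assume "M \<le> m"
    let ?C = "(T ^^ m) ` (A - ?U)"
    have TU: "(T ^^ m) ` ?U \<in> sets lebesgue"
      using funpow_image_measure[OF lim tower_measurable tower_subset_space] by blast
    have C: "?C \<in> sets lebesgue" "emeasure lebesgue ?C = emeasure lebesgue (A - ?U)"
      using funpow_image_measure[OF lim, of "A - ?U" m] A tower_measurable by auto
    have "(T ^^ m) ` A \<inter> B \<subseteq> (?U \<inter> (T ^^ m) ` ?U) \<union> (?C \<union> (B - ?U))" by blast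
    then have "emeasure lebesgue ((T ^^ m) ` A \<inter> B)
        \<le> emeasure lebesgue ((?U \<inter> (T ^^ m) ` ?U) \<union> (?C \<union> (B - ?U)))"
      using TU C B tower_measurable by (intro emeasure_mono) auto
    also have "\<dots> \<le> emeasure lebesgue (?U \<inter> (T ^^ m) ` ?U) + emeasure lebesgue (?C \<union> (B - ?U))"
      using TU C B tower_measurable by (intro emeasure_subadditive) auto
    also have "\<dots> \<le> emeasure lebesgue (?U \<inter> (T ^^ m) ` ?U)
        + (emeasure lebesgue ?C + emeasure lebesgue (B - ?U))"
      using C B tower_measurable by (intro add_left_mono emeasure_subadditive) auto
    also have "\<dots> < ennreal \<delta> + (ennreal \<delta> + ennreal \<delta>)"
      using M[OF \<open>M \<le> m\<close>] C(2) p by (intro add_strict_mono) auto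
    also have "\<dots> = ennreal \<epsilon>" using \<delta> by (simp add: \<delta>_def flip: ennreal_plus)
    finally show "emeasure lebesgue ((T ^^ m) ` A \<inter> B) < ennreal \<epsilon>" .
  qed
qed

text \<open>
  Apply the measure-preserving \<open>T ^^ m\<close> to the left-hand set: the image lies in
  \<open>(T ^^ m) ` B \<inter> A\<close>. If the left-hand set is not measurable, its \<open>emeasure\<close> is 0 by convention.
\<close>

lemma emeasure_vimage_le:
  assumes lim: "filterlim r at_top sequentially"
    and A: "A \<in> sets lebesgue" and B: "B \<in> sets lebesgue" "B \<subseteq> X"
  shows "emeasure lebesgue ((T ^^ m) -` A \<inter> X \<inter> B) \<le> emeasure lebesgue ((T ^^ m) ` B \<inter> A)"
proof (cases "(T ^^ m) -` A \<inter> X \<inter> B \<in> sets lebesgue")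
  case True
  then have "emeasure lebesgue ((T ^^ m) -` A \<inter> X \<inter> B)
      = emeasure lebesgue ((T ^^ m) ` ((T ^^ m) -` A \<inter> X \<inter> B))"
    using funpow_image_measure[OF lim True, of m] B(2) by (metis inf.coboundedI2)
  also have "\<dots> \<le> emeasure lebesgue ((T ^^ m) ` B \<inter> A)"
    using A funpow_image_measure[OF lim B, of m] by (intro emeasure_mono) (blast, blast intro: sets.Int)
  finally show ?thesis .
next
  case False
  then show ?thesis by (simp add: emeasure_notin_sets)
qed

end

theorem mainTheorem4:
  fixes h r :: "nat \<Rightarrow> nat"
    and s :: "nat \<Rightarrow> nat \<Rightarrow> nat"
    and E :: "nat \<Rightarrow> real set"
    and Ec :: "nat \<Rightarrow> nat \<Rightarrow> real set"
    and X :: "real set"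
    and T :: "real \<Rightarrow> real"
  assumes "rank_one_construction h r s E Ec X T"
    and "emeasure (lebesgue_on X) X = \<infinity>"
    and "filterlim r at_top sequentially"
    and "sidon_construction h r E Ec T"
  shows "infinite_mixing (lebesgue_on X) T"
proof -
  interpret rank_one_construction h r s E Ec X T by fact
  have X: "X \<inter> space lebesgue \<in> sets lebesgue" using space_measurable by simp
  have sets_iff: "A \<in> sets (lebesgue_on X) \<longleftrightarrow> A \<in> sets lebesgue \<and> A \<subseteq> X" for A
    using sets_restrict_space_iff[OF X] by auto
  have em: "emeasure (lebesgue_on X) A = emeasure lebesgue A" if "A \<subseteq> X" for A
    using emeasure_restrict_space[OF X] that by simp
  show ?thesis
    unfolding infinite_mixing_def
  proof (intro allI ballI impI)
    fix \<epsilon> :: real and A B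
    assume AB: "A \<in> sets (lebesgue_on X)" "B \<in> sets (lebesgue_on X)"
      and *: "\<epsilon> > 0 \<and> emeasure (lebesgue_on X) A < \<infinity> \<and> emeasure (lebesgue_on X) B < \<infinity>"
    have A: "A \<in> sets lebesgue" "A \<subseteq> X" "emeasure lebesgue A < \<infinity>"
      and B: "B \<in> sets lebesgue" "B \<subseteq> X" "emeasure lebesgue B < \<infinity>"
      using AB * sets_iff em by auto
    obtain M where M: "\<And>m. m \<ge> M \<Longrightarrow> emeasure lebesgue ((T ^^ m) ` A \<inter> B) < ennreal \<epsilon>"
      using forward_mixing[OF assms(3,4) A B] * by blast
    obtain M' where M': "\<And>m. m \<ge> M' \<Longrightarrow> emeasure lebesgue ((T ^^ m) ` B \<inter> A) < ennreal \<epsilon>"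
      using forward_mixing[OF assms(3,4) B A] * by blast
    show "\<exists>N::int. \<forall>k::int. \<bar>k\<bar> > N \<longrightarrow>
        emeasure (lebesgue_on X) (power_image (lebesgue_on X) T k A \<inter> B) < ennreal \<epsilon>"
    proof (intro exI[of _ "int (max M M')"] allI impI)
      fix k :: int assume k: "\<bar>k\<bar> > int (max M M')"
      have "power_image (lebesgue_on X) T k A \<inter> B \<subseteq> X" using B(2) by blast
      note em = em[OF this]
      show "emeasure (lebesgue_on X) (power_image (lebesgue_on X) T k A \<inter> B) < ennreal \<epsilon>"
      proof (cases "k \<ge> 0")
        case True
        then show ?thesis using M[of "nat k"] k by (simp add: em) (simp add: power_image_def)
      next
        case False
        \<comment> \<open>For negative powers the sets \<open>A\<close> and \<open>B\<close> exchange their roles.\<close>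
        have "emeasure lebesgue ((T ^^ nat (- k)) -` A \<inter> X \<inter> B)
            \<le> emeasure lebesgue ((T ^^ nat (- k)) ` B \<inter> A)"
          by (rule emeasure_vimage_le[OF assms(3) A(1) B(1,2)])
        also have "\<dots> < ennreal \<epsilon>" using False k by (intro M') simp
        finally show ?thesis using False by (simp add: em) (simp add: power_image_def)
      qed
    qed
  qed
qed

end
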